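(* Let $F$ be a finite field. Then the product ring $\prod_{\mathbb{N}} F$ is stably coherent.
   Context: All rings are commutative with identity. $\prod_{\mathbb{N}}F$ is the product of countably infinitely many copies of $F$ with componentwise operations. A ring is coherent if each of its finitely generated ideals is finitely presented. A ring $R$ is stably coherent if the polynomial ring $R[X_1,\ldots,X_n]$ is coherent for every finite number $n$ of variables. *)

theory Defs
  imports "HOL-Algebra.Algebra" "HOL-Library.Multiset"
begin

section \<open>Product rings\<close>

text \<open>The ring analogue of \<^const>\<open>product_group\<close>.\<close>

definition product_ring :: "'i set \<Rightarrow> ('i \<Rightarrow> ('a, 'm) ring_scheme) \<Rightarrow> ('i \<Rightarrow> 'a) ring"
  where "product_ring I R = \<lparr>
    carrier = (\<Pi>\<^sub>E i\<in>I. carrier (R i)),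
    monoid.mult = (\<lambda>x y. \<lambda>i\<in>I. x i \<otimes>\<^bsub>R i\<^esub> y i),
    one = (\<lambda>i\<in>I. \<one>\<^bsub>R i\<^esub>),
    ring.zero = (\<lambda>i\<in>I. \<zero>\<^bsub>R i\<^esub>),
    ring.add = (\<lambda>x y. \<lambda>i\<in>I. x i \<oplus>\<^bsub>R i\<^esub> y i)\<rparr>"


section \<open>Polynomial rings in finitely many variables\<close>

text \<open>
  As in \<^theory>\<open>HOL-Algebra.Indexed_Polynomials\<close>, a monomial is the multiset of its
  variables (here numbered \<open>0, \<dots>, n - 1\<close>), and a polynomial is the function sending
  each monomial to its coefficient. Multiplying monomials is adding multisets, so the
  factorisations of \<open>m\<close> are the pairs \<open>(k, m - k)\<close> with \<open>k \<subseteq># m\<close>.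
\<close>

definition mpoly_ring :: "('a, 'm) ring_scheme \<Rightarrow> nat \<Rightarrow> (nat multiset \<Rightarrow> 'a) ring"
  where "mpoly_ring R n = \<lparr>
    carrier = {p. (\<forall>m. p m \<in> carrier R) \<and> finite {m. p m \<noteq> \<zero>\<^bsub>R\<^esub>} \<and>
                  (\<forall>m. p m \<noteq> \<zero>\<^bsub>R\<^esub> \<longrightarrow> set_mset m \<subseteq> {..<n})},
    monoid.mult = (\<lambda>p q m. \<Oplus>\<^bsub>R\<^esub>k\<in>{k. k \<subseteq># m}. p k \<otimes>\<^bsub>R\<^esub> q (m - k)),
    one = (\<lambda>m. if m = {#} then \<one>\<^bsub>R\<^esub> else \<zero>\<^bsub>R\<^esub>),
    ring.zero = (\<lambda>m. \<zero>\<^bsub>R\<^esub>),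
    ring.add = (\<lambda>p q m. p m \<oplus>\<^bsub>R\<^esub> q m)\<rparr>"


section \<open>Finitely presented modules\<close>

definition submodule_gen ::
    "('a, 'm) ring_scheme \<Rightarrow> ('a, 'b, 'n) module_scheme \<Rightarrow> 'b set \<Rightarrow> 'b set"
  where "submodule_gen R M S = \<Inter>{H. submodule H R M \<and> S \<subseteq> H}"

definition finitely_generated_submodule ::
    "('a, 'm) ring_scheme \<Rightarrow> ('a, 'b, 'n) module_scheme \<Rightarrow> 'b set \<Rightarrow> bool"
  where "finitely_generated_submodule R M N \<longleftrightarrow>
    (\<exists>S. finite S \<and> S \<subseteq> carrier M \<and> N = submodule_gen R M S)"

definition module_hom ::
    "('a, 'm) ring_scheme \<Rightarrow> ('a, 'b, 'n) module_scheme \<Rightarrow> ('a, 'c, 'k) module_scheme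
      \<Rightarrow> ('b \<Rightarrow> 'c) set"
  where "module_hom R M N = {f \<in> carrier M \<rightarrow> carrier N.
    (\<forall>x\<in>carrier M. \<forall>y\<in>carrier M. f (x \<oplus>\<^bsub>M\<^esub> y) = f x \<oplus>\<^bsub>N\<^esub> f y) \<and>
    (\<forall>a\<in>carrier R. \<forall>x\<in>carrier M. f (a \<odot>\<^bsub>M\<^esub> x) = a \<odot>\<^bsub>N\<^esub> f x)}"

definition free_module :: "('a, 'm) ring_scheme \<Rightarrow> nat \<Rightarrow> ('a, nat \<Rightarrow> 'a) module"
  where "free_module R n = ring.extend (product_ring {..<n} (\<lambda>_. R))
    \<lparr>smult = (\<lambda>a x. \<lambda>i\<in>{..<n}. a \<otimes>\<^bsub>R\<^esub> x i)\<rparr>"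

text \<open>Exactness of \<open>R\<^sup>m \<rightarrow> R\<^sup>n \<rightarrow> M \<rightarrow> 0\<close> for some \<open>m\<close> and \<open>n\<close>:
  the kernel of the surjection is a finitely generated submodule.\<close>

definition finitely_presented ::
    "('a, 'm) ring_scheme \<Rightarrow> ('a, 'b, 'n) module_scheme \<Rightarrow> bool"
  where "finitely_presented R M \<longleftrightarrow>
    (\<exists>n. \<exists>f \<in> module_hom R (free_module R n) M.
      f ` carrier (free_module R n) = carrier M \<and>
      finitely_generated_submodule R (free_module R n)
        {x \<in> carrier (free_module R n). f x = \<zero>\<^bsub>M\<^esub>})"


section \<open>Coherent and stably coherent rings\<close>

text \<open>An ideal regarded as a module; the fields \<open>mult\<close> and \<open>one\<close> play no role.\<close>

definition ideal_module :: "('a, 'm) ring_scheme \<Rightarrow> 'a set \<Rightarrow> ('a, 'a) module"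
  where "ideal_module R I = \<lparr>carrier = I, monoid.mult = (\<otimes>\<^bsub>R\<^esub>), one = \<one>\<^bsub>R\<^esub>,
    ring.zero = \<zero>\<^bsub>R\<^esub>, ring.add = (\<oplus>\<^bsub>R\<^esub>), smult = (\<otimes>\<^bsub>R\<^esub>)\<rparr>"

locale coherent_ring = cring +
  assumes fg_ideal_finitely_presented:
    "\<lbrakk>finite S; S \<subseteq> carrier R\<rbrakk> \<Longrightarrow> finitely_presented R (ideal_module R (Idl S))"

locale stably_coherent_ring = cring +
  assumes mpoly_ring_coherent: "coherent_ring (mpoly_ring R n)"

end

theory Submission
  imports Defs "HOL-Library.Multiset_Order" "HOL-Library.Product_Lexorder"
begin

text \<open>
  A polynomial over \<open>\<Prod>\<^sub>\<nat> F\<close> has finitely many nonzero coefficients, and each of them, being a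
  sequence in the finite set \<open>F\<close>, takes finitely many values. So reading off the coefficients at
  an index \<open>i\<close> turns it into a function \<open>\<nat> \<rightarrow> F[X\<^sub>1, \<dots>, X\<^sub>n]\<close> with finite range, and
  every function with finite range arises in this way
  (\<open>mpoly_product_ring_finite_valued\<close>). The question is thus why the ring \<open>Q\<close> of functions
  of finite range into \<open>A = F[X\<^sub>1, \<dots>, X\<^sub>n]\<close> is coherent. A finitely generated ideal is finitely
  presented as soon as the relations (syzygies) between its generators form a finitely generated
  module (\<open>coherent_ring_syzygiesI\<close>), so it is enough to treat the syzygies of
  \<open>g\<^sub>1, \<dots>, g\<^sub>s \<in> Q\<close>.

  The vector \<open>(g\<^sub>1, \<dots>, g\<^sub>s)\<close> takes finitely many values \<open>t\<close>, and so splits the index set into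
  finitely many pieces. On a piece, a syzygy over \<open>Q\<close> is a function with finite range whose values
  are syzygies of the constant vector \<open>t\<close> over \<open>A\<close>. Finitely many of these generate, because \<open>A\<close>
  is Noetherian. Extending such generators by zero outside their piece gives finitely many
  syzygies over \<open>Q\<close>. They generate all others: after cutting the pieces further, any given
  syzygy is constant on each of finitely many parts, and the idempotents of \<open>Q\<close> allow one to
  work on each part separately (\<open>syzygies_finitely_generated\<close>).

  That every submodule of \<open>A\<^sup>s\<close> is finitely generated (\<open>submodule_mpoly_finitely_generated\<close>) is
  Hilbert's basis theorem. It is proved here for all variables and all \<open>s\<close> positions at once by
  leading terms: Dickson's lemma (\<open>dickson\<close>) provides finitely many elements whose leading terms
  divide all others, and repeated division by them (\<open>leading_term_cancel\<close>) ends because the terms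
  are well-ordered.
\<close>

section \<open>Finite products and sums over submultisets\<close>

lemma (in comm_monoid) finprod_Sigma:
  assumes "finite A" and "\<And>a. a \<in> A \<Longrightarrow> finite (B a)"
    and "\<And>a b. a \<in> A \<Longrightarrow> b \<in> B a \<Longrightarrow> f a b \<in> carrier G"
  shows "(\<Otimes>a\<in>A. \<Otimes>b\<in>B a. f a b) = (\<Otimes>z\<in>Sigma A B. f (fst z) (snd z))"
  using assms
proof (induction A rule: finite_induct)
  case (insert a A)
  let ?f = "\<lambda>z. f (fst z) (snd z)"
  have split: "Sigma (insert a A) B = Pair a ` B a \<union> Sigma A B" by auto
  have "(\<Otimes>z\<in>Pair a ` B a. ?f z) = (\<Otimes>b\<in>B a. f a b)"
    using insert.prems by (subst finprod_reindex) (auto simp: inj_on_def)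
  moreover have "(\<Otimes>z\<in>Pair a ` B a \<union> Sigma A B. ?f z)
      = (\<Otimes>z\<in>Pair a ` B a. ?f z) \<otimes> (\<Otimes>z\<in>Sigma A B. ?f z)"
    using insert by (intro finprod_Un_disjoint) (auto intro!: finite_SigmaI)
  ultimately show ?case
    using insert unfolding split by (subst finprod_insert) (auto simp: Pi_def)
qed simp

lemma (in comm_monoid) finprod_reindex_bij_betw:
  assumes "bij_betw h A B" and "f \<in> B \<rightarrow> carrier G"
  shows "finprod G f B = (\<Otimes>a\<in>A. f (h a))"
  using assms finprod_reindex[of f h A] by (simp add: bij_betw_def)

lemma finite_submultisets [simp]: "finite {k. k \<subseteq># m}"
proof (induction m)
  case (add x m)
  have "k \<subseteq># m \<or> k \<in> add_mset x ` {k. k \<subseteq># m}" if "k \<subseteq># add_mset x m" for k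
  proof (cases "x \<in># k")
    case True
    then obtain k' where "k = add_mset x k'" by (blast dest: multi_member_split)
    then show ?thesis using that by auto
  next
    case False
    then show ?thesis using that
      by (metis add_mset_remove_trivial diff_single_trivial subset_eq_diff_conv add_mset_add_single)
  qed
  then have "{k. k \<subseteq># add_mset x m} \<subseteq> {k. k \<subseteq># m} \<union> add_mset x ` {k. k \<subseteq># m}" by blast
  with add show ?case by (meson finite_UnI finite_imageI finite_subset)
qed auto

section \<open>Product rings\<close>

lemma product_ring_cring:
  assumes R: "\<And>i. i \<in> I \<Longrightarrow> cring (R i)"
  shows "cring (product_ring I R)"
proof (intro cringI abelian_groupI comm_monoidI)
  note ops = cring.cring_simprules[OF R]
  let ?P = "product_ring I R"
  fix x assume x: "x \<in> carrier ?P"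
  show "\<exists>y\<in>carrier ?P. y \<oplus>\<^bsub>?P\<^esub> x = \<zero>\<^bsub>?P\<^esub>"
    using x by (intro bexI[of _ "\<lambda>i\<in>I. \<ominus>\<^bsub>R i\<^esub> x i"])
      (auto simp: product_ring_def PiE_iff ops intro!: restrict_ext)
qed (auto simp: product_ring_def PiE_iff extensional_def fun_eq_iff
      cring.cring_simprules[OF R] monoid.r_one[OF ring.is_monoid[OF cring.axioms(1)[OF R]]])

lemma product_ring_simps:
  "carrier (product_ring UNIV R) = {x. \<forall>i. x i \<in> carrier (R i)}"
  "\<zero>\<^bsub>product_ring UNIV R\<^esub> = (\<lambda>i. \<zero>\<^bsub>R i\<^esub>)"
  "\<one>\<^bsub>product_ring UNIV R\<^esub> = (\<lambda>i. \<one>\<^bsub>R i\<^esub>)"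
  "x \<oplus>\<^bsub>product_ring UNIV R\<^esub> y = (\<lambda>i. x i \<oplus>\<^bsub>R i\<^esub> y i)"
  "x \<otimes>\<^bsub>product_ring UNIV R\<^esub> y = (\<lambda>i. x i \<otimes>\<^bsub>R i\<^esub> y i)"
  by (auto simp: product_ring_def)

lemma product_ring_proj:
  assumes "\<And>i. cring (R i)"
  shows "ring_hom_cring (product_ring UNIV R) (R i) (\<lambda>x. x i)"
  by (intro ring_hom_cring.intro ring_hom_cring_axioms.intro ring_hom_memI product_ring_cring assms)
    (simp_all add: product_ring_simps)

section \<open>The ring of polynomials\<close>

lemma mpoly_ring_simps:
  "\<zero>\<^bsub>mpoly_ring R n\<^esub> = (\<lambda>m. \<zero>\<^bsub>R\<^esub>)"
  "\<one>\<^bsub>mpoly_ring R n\<^esub> = (\<lambda>m. if m = {#} then \<one>\<^bsub>R\<^esub> else \<zero>\<^bsub>R\<^esub>)"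
  "p \<oplus>\<^bsub>mpoly_ring R n\<^esub> q = (\<lambda>m. p m \<oplus>\<^bsub>R\<^esub> q m)"
  "p \<otimes>\<^bsub>mpoly_ring R n\<^esub> q = (\<lambda>m. \<Oplus>\<^bsub>R\<^esub>k\<in>{k. k \<subseteq># m}. p k \<otimes>\<^bsub>R\<^esub> q (m - k))"
  by (simp_all add: mpoly_ring_def)

lemma mpoly_carrier_iff:
  "p \<in> carrier (mpoly_ring R n) \<longleftrightarrow> (\<forall>m. p m \<in> carrier R) \<and> finite {m. p m \<noteq> \<zero>\<^bsub>R\<^esub>} \<and>
     (\<forall>m. p m \<noteq> \<zero>\<^bsub>R\<^esub> \<longrightarrow> set_mset m \<subseteq> {..<n})"
  by (simp only: mpoly_ring_def partial_object.simps mem_Collect_eq)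

lemma mpoly_coeff_closed [simp]: "p \<in> carrier (mpoly_ring R n) \<Longrightarrow> p m \<in> carrier R"
  unfolding mpoly_carrier_iff by blast

lemma mpoly_finite_support: "p \<in> carrier (mpoly_ring R n) \<Longrightarrow> finite {m. p m \<noteq> \<zero>\<^bsub>R\<^esub>}"
  unfolding mpoly_carrier_iff by blast

lemma mpoly_vars: "p \<in> carrier (mpoly_ring R n) \<Longrightarrow> p m \<noteq> \<zero>\<^bsub>R\<^esub> \<Longrightarrow> set_mset m \<subseteq> {..<n}"
  unfolding mpoly_carrier_iff by blast

lemma mpoly_carrierI:
  assumes "\<And>m. p m \<in> carrier R" and "finite M" and "\<And>m. p m \<noteq> \<zero>\<^bsub>R\<^esub> \<Longrightarrow> m \<in> M"
    and "\<And>m. p m \<noteq> \<zero>\<^bsub>R\<^esub> \<Longrightarrow> set_mset m \<subseteq> {..<n}"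
  shows "p \<in> carrier (mpoly_ring R n)"
proof -
  have "{m. p m \<noteq> \<zero>\<^bsub>R\<^esub>} \<subseteq> M" using assms(3) by blast
  then show ?thesis unfolding mpoly_carrier_iff using assms finite_subset by blast
qed

definition mpoly_monom :: "('a, 'm) ring_scheme \<Rightarrow> 'a \<Rightarrow> nat multiset \<Rightarrow> nat multiset \<Rightarrow> 'a"
  where "mpoly_monom R c d = (\<lambda>m. if m = d then c else \<zero>\<^bsub>R\<^esub>)"

text \<open>
  Both sets parametrise the factorisations of \<open>m\<close> into three monomials: \<open>(j, l)\<close> stands for
  \<open>j, l, m - j - l\<close>, and \<open>(k, j)\<close> for \<open>j, k - j, m - k\<close>. Reindexing along this bijection is the
  associativity of multiplication.
\<close>

lemma bij_betw_submultiset_pairs: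
  "bij_betw (\<lambda>(j, l). (j + l, j)) (SIGMA j:{j. j \<subseteq># m}. {l. l \<subseteq># m - j})
     (SIGMA k:{k. k \<subseteq># m}. {j. j \<subseteq># k})"
proof (rule bij_betw_byWitness[where f' = "\<lambda>(k, j). (j, k - j)"])
  show "(\<lambda>(j, l). (j + l, j)) ` (SIGMA j:{j. j \<subseteq># m}. {l. l \<subseteq># m - j})
      \<subseteq> (SIGMA k:{k. k \<subseteq># m}. {j. j \<subseteq># k})"
    by (auto simp: subset_mset.le_diff_conv2 add.commute)
  show "(\<lambda>(k, j). (j, k - j)) ` (SIGMA k:{k. k \<subseteq># m}. {j. j \<subseteq># k})
      \<subseteq> (SIGMA j:{j. j \<subseteq># m}. {l. l \<subseteq># m - j})"
    by (auto simp: subseteq_mset_def diff_le_mono intro: order_trans)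
qed auto

context cring
begin

lemma mpoly_monom_closed:
  "c \<in> carrier R \<Longrightarrow> set_mset d \<subseteq> {..<n} \<Longrightarrow> mpoly_monom R c d \<in> carrier (mpoly_ring R n)"
  by (rule mpoly_carrierI[where M = "{d}"]) (auto simp: mpoly_monom_def split: if_splits)

lemma mpoly_monom_mult:
  assumes c: "c \<in> carrier R" and p: "p \<in> carrier (mpoly_ring R n)"
  shows "mpoly_monom R c d \<otimes>\<^bsub>mpoly_ring R n\<^esub> p = (\<lambda>m. if d \<subseteq># m then c \<otimes> p (m - d) else \<zero>)"
proof
  fix m :: "nat multiset"
  have "(\<Oplus>k\<in>{k. k \<subseteq># m}. mpoly_monom R c d k \<otimes> p (m - k))
      = (\<Oplus>k\<in>{k. k \<subseteq># m}. if k = d then c \<otimes> p (m - k) else \<zero>)"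
    using c p by (intro finsum_cong') (auto simp: mpoly_monom_def)
  also have "\<dots> = (if d \<subseteq># m then c \<otimes> p (m - d) else \<zero>)"
    using c p by (auto intro!: add.finprod_singleton_swap add.finprod_one_eqI)
  finally show "(mpoly_monom R c d \<otimes>\<^bsub>mpoly_ring R n\<^esub> p) m
      = (if d \<subseteq># m then c \<otimes> p (m - d) else \<zero>)"
    by (simp add: mpoly_ring_simps)
qed

text \<open>
  A nonzero coefficient of the product comes from a pair of nonzero coefficients of the
  factors, which bounds both the support and the variables of the product.
\<close>

lemma mpoly_mult_closed:
  assumes p: "p \<in> carrier (mpoly_ring R n)" and q: "q \<in> carrier (mpoly_ring R n)"
  shows "p \<otimes>\<^bsub>mpoly_ring R n\<^esub> q \<in> carrier (mpoly_ring R n)"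
proof -
  let ?pq = "p \<otimes>\<^bsub>mpoly_ring R n\<^esub> q"
  let ?M = "(\<lambda>(k, l). k + l) ` ({m. p m \<noteq> \<zero>} \<times> {m. q m \<noteq> \<zero>})"
  have factors: "\<exists>k l. m = k + l \<and> p k \<noteq> \<zero> \<and> q l \<noteq> \<zero>" if "?pq m \<noteq> \<zero>" for m
  proof (rule ccontr)
    assume no: "\<not> ?thesis"
    have "p k \<otimes> q (m - k) = \<zero>" if "k \<subseteq># m" for k
    proof -
      have "p k = \<zero> \<or> q (m - k) = \<zero>"
        using no that by (metis subset_mset.add_diff_inverse)
      then show ?thesis using p q by auto
    qed
    then have "?pq m = \<zero>" by (auto simp: mpoly_ring_simps intro!: add.finprod_one_eqI)
    with that show False by simp
  qed
  show ?thesis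
  proof (rule mpoly_carrierI[where M = ?M])
    show "?pq m \<in> carrier R" for m
      using p q by (auto simp: mpoly_ring_simps intro!: finsum_closed)
    show "finite ?M" using p q by (simp add: mpoly_finite_support)
    show "m \<in> ?M" if "?pq m \<noteq> \<zero>" for m using factors[OF that] by force
    show "set_mset m \<subseteq> {..<n}" if "?pq m \<noteq> \<zero>" for m
      using factors[OF that] mpoly_vars[OF p] mpoly_vars[OF q] by force
  qed
qed

lemma mpoly_mult_assoc:
  assumes p: "p \<in> carrier (mpoly_ring R n)" and q: "q \<in> carrier (mpoly_ring R n)"
    and r: "r \<in> carrier (mpoly_ring R n)"
  shows "(p \<otimes>\<^bsub>mpoly_ring R n\<^esub> q) \<otimes>\<^bsub>mpoly_ring R n\<^esub> r
    = p \<otimes>\<^bsub>mpoly_ring R n\<^esub> (q \<otimes>\<^bsub>mpoly_ring R n\<^esub> r)"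
proof
  fix m :: "nat multiset"
  let ?S = "SIGMA k:{k. k \<subseteq># m}. {j. j \<subseteq># k}"
  let ?T = "SIGMA j:{j. j \<subseteq># m}. {l. l \<subseteq># m - j}"
  have [simp]: "p k \<in> carrier R" "q k \<in> carrier R" "r k \<in> carrier R" for k
    using p q r by simp_all
  have "((p \<otimes>\<^bsub>mpoly_ring R n\<^esub> q) \<otimes>\<^bsub>mpoly_ring R n\<^esub> r) m
      = (\<Oplus>k\<in>{k. k \<subseteq># m}. \<Oplus>j\<in>{j. j \<subseteq># k}. p j \<otimes> q (k - j) \<otimes> r (m - k))"
    by (auto simp: mpoly_ring_simps finsum_ldistr intro!: finsum_cong')
  also have "\<dots> = (\<Oplus>z\<in>?S. p (snd z) \<otimes> q (fst z - snd z) \<otimes> r (m - fst z))"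
    by (subst add.finprod_Sigma) auto
  also have "\<dots> = (\<Oplus>z\<in>?T. p (fst z) \<otimes> q (snd z) \<otimes> r (m - fst z - snd z))"
    by (subst add.finprod_reindex_bij_betw[OF bij_betw_submultiset_pairs])
      (auto intro!: finsum_cong')
  also have "\<dots> = (\<Oplus>j\<in>{j. j \<subseteq># m}. \<Oplus>l\<in>{l. l \<subseteq># m - j}. p j \<otimes> q l \<otimes> r (m - j - l))"
    by (subst add.finprod_Sigma) auto
  also have "\<dots> = (p \<otimes>\<^bsub>mpoly_ring R n\<^esub> (q \<otimes>\<^bsub>mpoly_ring R n\<^esub> r)) m"
    by (auto simp: mpoly_ring_simps finsum_rdistr m_assoc intro!: finsum_cong')
  finally show "((p \<otimes>\<^bsub>mpoly_ring R n\<^esub> q) \<otimes>\<^bsub>mpoly_ring R n\<^esub> r) m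
      = (p \<otimes>\<^bsub>mpoly_ring R n\<^esub> (q \<otimes>\<^bsub>mpoly_ring R n\<^esub> r)) m" .
qed

lemma mpoly_mult_comm:
  assumes p: "p \<in> carrier (mpoly_ring R n)" and q: "q \<in> carrier (mpoly_ring R n)"
  shows "p \<otimes>\<^bsub>mpoly_ring R n\<^esub> q = q \<otimes>\<^bsub>mpoly_ring R n\<^esub> p"
proof
  fix m :: "nat multiset"
  have "bij_betw (\<lambda>k. m - k) {k. k \<subseteq># m} {k. k \<subseteq># m}"
    by (rule bij_betw_byWitness[where f' = "\<lambda>k. m - k"])
      (auto simp: multiset_eq_iff subseteq_mset_def)
  then have "(\<Oplus>k\<in>{k. k \<subseteq># m}. p k \<otimes> q (m - k))
      = (\<Oplus>k\<in>{k. k \<subseteq># m}. p (m - k) \<otimes> q (m - (m - k)))"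
    using p q by (subst add.finprod_reindex_bij_betw) auto
  also have "\<dots> = (\<Oplus>k\<in>{k. k \<subseteq># m}. q k \<otimes> p (m - k))"
  proof (intro finsum_cong')
    fix k assume "k \<in> {k. k \<subseteq># m}"
    then have "m - (m - k) = k" by (auto simp: multiset_eq_iff subseteq_mset_def)
    then show "p (m - k) \<otimes> q (m - (m - k)) = q k \<otimes> p (m - k)"
      using p q by (simp add: m_comm)
  qed (use p q in auto)
  finally show "(p \<otimes>\<^bsub>mpoly_ring R n\<^esub> q) m = (q \<otimes>\<^bsub>mpoly_ring R n\<^esub> p) m"
    by (simp add: mpoly_ring_simps)
qed

lemma mpoly_ring_cring: "cring (mpoly_ring R n)"
proof (intro cringI abelian_groupI comm_monoidI)
  let ?A = "mpoly_ring R n"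
  fix p q r assume p: "p \<in> carrier ?A"
  show "\<one>\<^bsub>?A\<^esub> \<otimes>\<^bsub>?A\<^esub> p = p"
    using p mpoly_monom_mult[of \<one> p n "{#}"]
    by (simp add: mpoly_ring_simps(2) mpoly_monom_def)
  show "\<exists>q\<in>carrier ?A. q \<oplus>\<^bsub>?A\<^esub> p = \<zero>\<^bsub>?A\<^esub>"
  proof
    show "(\<lambda>m. \<ominus> p m) \<in> carrier ?A"
      using p mpoly_vars[OF p] 
      by (intro mpoly_carrierI[where M = "{m. p m \<noteq> \<zero>}"]) (auto simp: mpoly_finite_support)
  qed (use p in \<open>simp add: mpoly_ring_simps l_neg\<close>)
  assume q: "q \<in> carrier ?A"
  show "p \<oplus>\<^bsub>?A\<^esub> q \<in> carrier ?A"
  proof (rule mpoly_carrierI[where M = "{m. p m \<noteq> \<zero>} \<union> {m. q m \<noteq> \<zero>}"])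
    fix m assume "(p \<oplus>\<^bsub>?A\<^esub> q) m \<noteq> \<zero>"
    then have "p m \<noteq> \<zero> \<or> q m \<noteq> \<zero>" by (auto simp: mpoly_ring_simps)
    then show "m \<in> {m. p m \<noteq> \<zero>} \<union> {m. q m \<noteq> \<zero>}" and "set_mset m \<subseteq> {..<n}"
      using mpoly_vars[OF p] mpoly_vars[OF q] by blast+
  qed (use p q in \<open>auto simp: mpoly_ring_simps mpoly_finite_support\<close>)
  show "p \<oplus>\<^bsub>?A\<^esub> q = q \<oplus>\<^bsub>?A\<^esub> p"
    using p q by (simp add: mpoly_ring_simps a_comm)
  assume r: "r \<in> carrier ?A"
  show "(p \<oplus>\<^bsub>?A\<^esub> q) \<oplus>\<^bsub>?A\<^esub> r = p \<oplus>\<^bsub>?A\<^esub> (q \<oplus>\<^bsub>?A\<^esub> r)"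
    using p q r by (simp add: mpoly_ring_simps a_assoc)
  show "(p \<oplus>\<^bsub>?A\<^esub> q) \<otimes>\<^bsub>?A\<^esub> r = p \<otimes>\<^bsub>?A\<^esub> r \<oplus>\<^bsub>?A\<^esub> q \<otimes>\<^bsub>?A\<^esub> r"
  proof
    fix m
    have "(\<Oplus>k\<in>{k. k \<subseteq># m}. (p k \<oplus> q k) \<otimes> r (m - k))
        = (\<Oplus>k\<in>{k. k \<subseteq># m}. p k \<otimes> r (m - k) \<oplus> q k \<otimes> r (m - k))"
      using p q r by (intro finsum_cong') (auto simp: l_distr)
    also have "\<dots> = (\<Oplus>k\<in>{k. k \<subseteq># m}. p k \<otimes> r (m - k)) \<oplus> (\<Oplus>k\<in>{k. k \<subseteq># m}. q k \<otimes> r (m - k))"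
      using p q r by (intro finsum_addf) auto
    finally show "((p \<oplus>\<^bsub>?A\<^esub> q) \<otimes>\<^bsub>?A\<^esub> r) m = (p \<otimes>\<^bsub>?A\<^esub> r \<oplus>\<^bsub>?A\<^esub> q \<otimes>\<^bsub>?A\<^esub> r) m"
      by (simp add: mpoly_ring_simps)
  qed
  show "p \<otimes>\<^bsub>?A\<^esub> q \<otimes>\<^bsub>?A\<^esub> r = p \<otimes>\<^bsub>?A\<^esub> (q \<otimes>\<^bsub>?A\<^esub> r)"
    using p q r by (rule mpoly_mult_assoc)
qed (use mpoly_mult_closed mpoly_mult_comm in
  \<open>auto intro!: mpoly_carrierI[where M = "{{#}}"] simp: mpoly_ring_simps split: if_splits\<close>)

end

section \<open>Free modules\<close>

lemma free_module_simps:
  "carrier (free_module R n) = (\<Pi>\<^sub>E i\<in>{..<n}. carrier R)"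
  "\<zero>\<^bsub>free_module R n\<^esub> = (\<lambda>i\<in>{..<n}. \<zero>\<^bsub>R\<^esub>)"
  "x \<oplus>\<^bsub>free_module R n\<^esub> y = (\<lambda>i\<in>{..<n}. x i \<oplus>\<^bsub>R\<^esub> y i)"
  "a \<odot>\<^bsub>free_module R n\<^esub> x = (\<lambda>i\<in>{..<n}. a \<otimes>\<^bsub>R\<^esub> x i)"
  by (simp_all add: free_module_def product_ring_def ring.defs)

lemma (in cring) free_module_module: "module R (free_module R n)"
proof (rule moduleI)
  let ?M = "free_module R n"
  show "abelian_group ?M"
  proof (rule abelian_groupI)
    fix x assume x: "x \<in> carrier ?M"
    show "\<exists>y\<in>carrier ?M. y \<oplus>\<^bsub>?M\<^esub> x = \<zero>\<^bsub>?M\<^esub>"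
      using x by (intro bexI[of _ "\<lambda>i\<in>{..<n}. \<ominus> x i"])
        (auto simp: free_module_simps PiE_iff l_neg intro!: restrict_ext)
  qed (auto simp: free_module_simps PiE_iff extensional_def fun_eq_iff a_ac)
qed (auto simp: free_module_simps PiE_iff extensional_def fun_eq_iff m_assoc l_distr r_distr
    intro: is_cring)

text \<open>Closure under negation is the case \<open>a = - 1\<close> of closure under scalar multiplication.\<close>

lemma (in module) submodule_closedI:
  assumes "H \<subseteq> carrier M" and "\<zero>\<^bsub>M\<^esub> \<in> H"
    and "\<And>x y. x \<in> H \<Longrightarrow> y \<in> H \<Longrightarrow> x \<oplus>\<^bsub>M\<^esub> y \<in> H"
    and "\<And>a x. a \<in> carrier R \<Longrightarrow> x \<in> H \<Longrightarrow> a \<odot>\<^bsub>M\<^esub> x \<in> H"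
  shows "submodule H R M"
proof (rule submoduleI)
  fix x assume x: "x \<in> H"
  then have "\<ominus>\<^bsub>M\<^esub> x = (\<ominus> \<one>) \<odot>\<^bsub>M\<^esub> x"
    using assms(1) smult_l_minus[of \<one> x] by auto
  then show "\<ominus>\<^bsub>M\<^esub> x \<in> H" using assms(4)[of "\<ominus> \<one>" x] x by simp
qed (use assms in auto)

section \<open>Dickson's lemma\<close>

text \<open>
  A monotone subsequence exists over any linear order; if it decreases, then over the naturals
  it is constant from the index on where it attains its minimum.
\<close>

lemma nat_seq_incseq_subseq:
  fixes g :: "nat \<Rightarrow> nat"
  shows "\<exists>r. strict_mono r \<and> incseq (g \<circ> r)"
proof -
  obtain r where r: "strict_mono r" and mono: "monoseq (\<lambda>i. g (r i))"
    using seq_monosub by blast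
  show ?thesis
  proof (cases "incseq (\<lambda>i. g (r i))")
    case True
    with r show ?thesis by (auto simp: comp_def)
  next
    case False
    then have dec: "decseq (\<lambda>i. g (r i))" using mono by (simp add: monoseq_iff)
    obtain N where N: "\<And>i. g (r N) \<le> g (r i)"
      using ex_has_least_nat[of "\<lambda>_. True" undefined "\<lambda>i. g (r i)"] by blast
    have "g (r (N + i)) = g (r N)" for i
      using N[of "N + i"] decseqD[OF dec, of N "N + i"] by simp
    then have "incseq (g \<circ> (\<lambda>i. r (N + i)))" by (simp add: incseq_def)
    moreover have "strict_mono (\<lambda>i. r (N + i))"
      using r by (simp add: strict_mono_def)
    ultimately show ?thesis by blast
  qed
qed

text \<open>
  One thins out the sequence once for each variable; what is monotone stays so on subsequences.
\<close>

lemma multiset_seq_mono_subseq: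
  fixes f :: "nat \<Rightarrow> nat multiset"
  shows "\<exists>r. strict_mono r \<and> (\<forall>v<n. incseq (\<lambda>i. count (f (r i)) v))"
proof (induction n)
  case 0
  show ?case by (rule exI[of _ id]) (simp add: strict_mono_def)
next
  case (Suc n)
  then obtain r where r: "strict_mono r" "\<forall>v<n. incseq (\<lambda>i. count (f (r i)) v)" by blast
  obtain u where u: "strict_mono u" "incseq ((\<lambda>i. count (f (r i)) n) \<circ> u)"
    using nat_seq_incseq_subseq by blast
  have "incseq (\<lambda>i. count (f (r (u i))) v)" if "v < Suc n" for v
    using r u that by (cases "v = n") (auto simp: incseq_def comp_def strict_mono_less_eq)
  then show ?case
    using strict_mono_o[OF r(1) u(1)] by (intro exI[of _ "r \<circ> u"]) (simp add: comp_def)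
qed

text \<open>
  Dickson's lemma. Every element of \<open>S\<close> is divisible by one that is minimal under divisibility. If there
  were infinitely many of these, a sequence of distinct minimal elements would have a subsequence
  increasing in every variable, but no minimal element divides another.
\<close>

lemma dickson:
  fixes S :: "nat multiset set"
  assumes vars: "\<And>m. m \<in> S \<Longrightarrow> set_mset m \<subseteq> {..<n}"
  shows "\<exists>B\<subseteq>S. finite B \<and> (\<forall>m\<in>S. \<exists>b\<in>B. b \<subseteq># m)"
proof -
  define B where "B = {m \<in> S. \<forall>k\<in>S. k \<subseteq># m \<longrightarrow> k = m}"
  have "finite B"
  proof (rule ccontr)
    assume "infinite B"
    then obtain f :: "nat \<Rightarrow> nat multiset" where f: "inj f" "range f \<subseteq> B"
      using infinite_countable_subset by blast
    obtain r where r: "strict_mono r" "\<forall>v<n. incseq (\<lambda>i. count (f (r i)) v)"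
      using multiset_seq_mono_subseq by blast
    have in_B: "f i \<in> B" for i using f(2) by blast
    have "count (f (r 0)) v \<le> count (f (r 1)) v" for v
    proof (cases "v < n")
      case False
      then have "v \<notin># f (r 0)" using vars in_B unfolding B_def by blast
      then show ?thesis by (simp add: not_in_iff)
    qed (use r(2) in \<open>auto simp: incseq_def\<close>)
    then have "f (r 0) = f (r 1)"
      using in_B unfolding B_def subseteq_mset_def by blast
    then show False using injD[OF f(1)] strict_monoD[OF r(1), of 0 1] by fastforce
  qed
  moreover have "\<exists>b\<in>B. b \<subseteq># m" if "m \<in> S" for m
    using that
  proof (induction "size m" arbitrary: m rule: less_induct)
    case less
    show ?case
    proof (cases "m \<in> B")
      case False
      then obtain k where k: "k \<in> S" "k \<subset># m"
        using less.prems unfolding B_def by (auto simp: subset_mset.less_le)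
      then obtain b where "b \<in> B" "b \<subseteq># k" using less.hyps mset_subset_size by blast
      with k(2) show ?thesis using subset_mset.order_trans subset_mset.less_imp_le by blast
    qed blast
  qed
  ultimately show ?thesis by (intro exI[of _ B]) (auto simp: B_def)
qed

section \<open>Hilbert's basis theorem by leading terms\<close>

text \<open>
  The terms occurring in a vector of polynomials, as pairs of a position and a monomial. Such
  pairs are ordered lexicographically and monomials by the multiset order, which compares
  the exponents of the largest variable at which two monomials differ. This is a well-order compatible with multiplication by monomials, so that the maximum
  of the support serves as leading term.
\<close>

definition vec_support :: "('a, 'm) ring_scheme \<Rightarrow> nat \<Rightarrow> (nat \<Rightarrow> nat multiset \<Rightarrow> 'a) \<Rightarrow> (nat \<times> nat multiset) set"
  where "vec_support R s h = {(j, m). j < s \<and> h j m \<noteq> \<zero>\<^bsub>R\<^esub>}"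

lemma vec_support_finite:
  assumes "h \<in> carrier (free_module (mpoly_ring R n) s)"
  shows "finite (vec_support R s h)"
proof -
  have "vec_support R s h = (SIGMA j:{..<s}. {m. h j m \<noteq> \<zero>\<^bsub>R\<^esub>})"
    by (auto simp: vec_support_def)
  then show ?thesis
    using assms by (auto simp: free_module_simps PiE_iff intro!: finite_SigmaI mpoly_finite_support)
qed

lemma vec_support_empty_iff:
  assumes "h \<in> carrier (free_module (mpoly_ring R n) s)"
  shows "vec_support R s h = {} \<longleftrightarrow> h = \<zero>\<^bsub>free_module (mpoly_ring R n) s\<^esub>"
  using assms
  by (auto simp: vec_support_def free_module_simps mpoly_ring_simps fun_eq_iff PiE_iff extensional_def)

text \<open>
  One step of the division algorithm: multiply \<open>g\<close> by the monomial that moves its leading term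
  to that of \<open>h\<close>, with the coefficient that makes the two cancel. That coefficient is a quotient
  by the leading coefficient of \<open>g\<close>, which is where \<open>R\<close> has to be a field. Terms below the
  leading one of \<open>g\<close> stay below, since the order is compatible with multiplication.
\<close>

lemma (in field) leading_term_cancel:
  fixes h g :: "nat \<Rightarrow> nat multiset \<Rightarrow> 'a" and n s :: nat
  defines "A \<equiv> mpoly_ring R n"
  assumes h: "h \<in> carrier (free_module A s)" and g: "g \<in> carrier (free_module A s)"
    and lt_h: "(j, m) \<in> vec_support R s h" "\<And>t. t \<in> vec_support R s h \<Longrightarrow> t \<le> (j, m)"
    and lt_g: "(j, b) \<in> vec_support R s g" "\<And>t. t \<in> vec_support R s g \<Longrightarrow> t \<le> (j, b)"
    and bm: "b \<subseteq># m"
  shows "\<exists>a\<in>carrier A. \<forall>t\<in>vec_support R s (h \<oplus>\<^bsub>free_module A s\<^esub> a \<odot>\<^bsub>free_module A s\<^esub> g). t < (j, m)"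
proof -
  have jp: "j < s" "h j m \<noteq> \<zero>" "g j b \<noteq> \<zero>"
    using lt_h(1) lt_g(1) by (auto simp: vec_support_def)
  have hA: "h i \<in> carrier A" and gA: "g i \<in> carrier A" if "i < s" for i
    using h g that by (auto simp: free_module_simps)
  have hR: "h i k \<in> carrier R" and gR: "g i k \<in> carrier R" if "i < s" for i k
    using hA[OF that] gA[OF that] by (auto simp: A_def)
  have unit: "g j b \<in> Units R" using gR jp by (simp add: field_Units)
  define d c where "d = m - b" and "c = \<ominus> (h j m \<otimes> inv (g j b))"
  have c: "c \<in> carrier R" using hR jp unit by (simp add: c_def)
  have md: "m = b + d" "m - d = b" "d \<subseteq># m"
    using bm by (auto simp: d_def multiset_eq_iff subseteq_mset_def)
  have "set_mset m \<subseteq> {..<n}" using mpoly_vars[of "h j" R n m] hA jp by (simp add: A_def)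
  then have "set_mset d \<subseteq> {..<n}" using md(1) by simp
  then have a: "mpoly_monom R c d \<in> carrier A" using c by (simp add: A_def mpoly_monom_closed)
  let ?h' = "h \<oplus>\<^bsub>free_module A s\<^esub> mpoly_monom R c d \<odot>\<^bsub>free_module A s\<^esub> g"
  have coeff: "?h' i k = h i k \<oplus> (if d \<subseteq># k then c \<otimes> g i (k - d) else \<zero>)" if "i < s" for i k
    using that mpoly_monom_mult[OF c, of "g i" n] gA
    by (simp add: free_module_simps A_def mpoly_ring_simps(3))
  have "(i, k) < (j, m)" if ik: "(i, k) \<in> vec_support R s ?h'" for i k
  proof -
    have i: "i < s" and nz: "h i k \<oplus> (if d \<subseteq># k then c \<otimes> g i (k - d) else \<zero>) \<noteq> \<zero>"
      using ik coeff by (auto simp: vec_support_def)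
    have "(i, k) \<le> (j, m)"
    proof (cases "h i k = \<zero>")
      case False
      with i have "(i, k) \<in> vec_support R s h" by (simp add: vec_support_def)
      then show ?thesis by (rule lt_h(2))
    next
      case True
      then have dk: "d \<subseteq># k" and "g i (k - d) \<noteq> \<zero>" using nz c by (auto split: if_splits)
      then have "(i, k - d) \<in> vec_support R s g" using i by (simp add: vec_support_def)
      then have "(i, k - d) \<le> (j, b)" by (rule lt_g(2))
      moreover have "k = (k - d) + d" using dk by simp
      ultimately show ?thesis
        unfolding md(1) less_eq_prod_simp by (metis add_right_mono)
    qed
    moreover have "(i, k) \<noteq> (j, m)"
    proof
      assume "(i, k) = (j, m)"
      then have "h j m \<oplus> c \<otimes> g j b \<noteq> \<zero>" using nz md by simp
      moreover have "c \<otimes> g j b = \<ominus> (h j m)"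
        using hR gR jp unit by (simp add: c_def l_minus m_assoc)
      ultimately show False using hR jp by (simp add: r_neg)
    qed
    ultimately show ?thesis by (rule le_neq_trans)
  qed
  then show ?thesis using a by (intro bexI[of _ "mpoly_monom R c d"]) auto
qed

text \<open>
  Hilbert's basis theorem for submodules of free modules. The generators form a Groebner basis
  of \<open>H\<close>: their leading terms divide the leading terms of all nonzero elements of \<open>H\<close>.
\<close>

theorem (in field) submodule_mpoly_finitely_generated:
  assumes H: "submodule H (mpoly_ring R n) (free_module (mpoly_ring R n) s)"
  shows "finitely_generated_submodule (mpoly_ring R n) (free_module (mpoly_ring R n) s) H"
proof -
  define A where "A = mpoly_ring R n"
  define M where "M = free_module A s"
  interpret A: cring A unfolding A_def by (rule mpoly_ring_cring)
  interpret M: module A M unfolding M_def by (rule A.free_module_module)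
  note H = H[folded A_def, folded M_def]
  note sub = M.submoduleE[OF H]
  let ?supp = "vec_support R s"
  have finsupp: "finite (?supp h)" if "h \<in> carrier M" for h
    using that vec_support_finite unfolding M_def A_def by blast
  have suppz: "?supp h = {} \<longleftrightarrow> h = \<zero>\<^bsub>M\<^esub>" if "h \<in> carrier M" for h
    using that vec_support_empty_iff unfolding M_def A_def by blast
  define L where "L j = {m. \<exists>h\<in>H. ?supp h \<noteq> {} \<and> Max (?supp h) = (j, m)}" for j
  have lead: "(j, m) \<in> ?supp h \<and> (\<forall>t\<in>?supp h. t \<le> (j, m))"
    if "h \<in> H" "?supp h \<noteq> {}" "Max (?supp h) = (j, m)" for h j m
    using that finsupp[of h] sub(1) Max_in[of "?supp h"] Max_ge[of "?supp h"] by fastforce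
  have "set_mset m \<subseteq> {..<n}" if "m \<in> L j" for j m
  proof -
    from that obtain h where "h \<in> H" "(j, m) \<in> ?supp h" unfolding L_def using lead by blast
    then have "h j \<in> carrier A" "h j m \<noteq> \<zero>"
      using sub(1) by (auto simp: vec_support_def M_def free_module_simps)
    then show ?thesis using mpoly_vars[of "h j" R n m] by (simp add: A_def)
  qed
  then have "\<forall>j. \<exists>B\<subseteq>L j. finite B \<and> (\<forall>m\<in>L j. \<exists>b\<in>B. b \<subseteq># m)" using dickson by meson
  then obtain B where B: "\<And>j. B j \<subseteq> L j" "\<And>j. finite (B j)" "\<And>j m. m \<in> L j \<Longrightarrow> \<exists>b\<in>B j. b \<subseteq># m"
    by metis
  have "\<forall>t\<in>Sigma {..<s} B. \<exists>g\<in>H. ?supp g \<noteq> {} \<and> Max (?supp g) = t"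
    using B(1) unfolding L_def by fast
  then obtain G where G: "\<And>t. t \<in> Sigma {..<s} B \<Longrightarrow> G t \<in> H \<and> ?supp (G t) \<noteq> {} \<and> Max (?supp (G t)) = t"
    by metis
  let ?S = "G ` Sigma {..<s} B"
  have SH: "?S \<subseteq> H" using G by blast
  \<comment> \<open>Induction on the leading term of \<open>h\<close>: a division step by an element of \<open>?S\<close> lowers it.\<close>
  have in_K: "h \<in> K" if K: "submodule K A M" "?S \<subseteq> K" and "h \<in> H" for K h
  proof -
    note subK = M.submoduleE[OF K(1)]
    have zK: "\<zero>\<^bsub>M\<^esub> \<in> K"
      using subgroup.one_closed[OF submodule.axioms(1)[OF K(1)]] by simp
    have "h \<in> K" if "h \<in> H" "?supp h \<noteq> {}" "Max (?supp h) = t" for h t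
      using that
    proof (induction t arbitrary: h rule: less_induct)
      case (less t)
      obtain j m where t: "t = (j, m)" by fastforce
      have hl: "(j, m) \<in> ?supp h" "\<And>t. t \<in> ?supp h \<Longrightarrow> t \<le> (j, m)"
        using lead less.prems t by blast+
      have hM: "h \<in> carrier M" using less.prems sub(1) by blast
      have "m \<in> L j" using less.prems t unfolding L_def by blast
      then obtain b where b: "b \<in> B j" "b \<subseteq># m" using B(3) by blast
      define g where "g = G (j, b)"
      have jb: "(j, b) \<in> Sigma {..<s} B" using b hl(1) by (auto simp: vec_support_def)
      have g: "g \<in> H" "?supp g \<noteq> {}" "Max (?supp g) = (j, b)" and gK: "g \<in> K"
        using G[OF jb] jb K(2) unfolding g_def by blast+
      have gl: "(j, b) \<in> ?supp g" "\<And>t. t \<in> ?supp g \<Longrightarrow> t \<le> (j, b)"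
        using lead g by blast+
      have gM: "g \<in> carrier M" using g sub(1) by blast
      obtain a where a: "a \<in> carrier A"
        and lt: "\<forall>t\<in>?supp (h \<oplus>\<^bsub>M\<^esub> a \<odot>\<^bsub>M\<^esub> g). t < (j, m)"
        using leading_term_cancel[of h n s g j m b] hM gM hl gl b(2) unfolding M_def A_def by blast
      let ?h' = "h \<oplus>\<^bsub>M\<^esub> a \<odot>\<^bsub>M\<^esub> g"
      have h': "?h' \<in> H" using less.prems g a sub by blast
      have agK: "a \<odot>\<^bsub>M\<^esub> g \<in> K" using a gK subK by blast
      have "?h' \<in> K"
      proof (cases "?supp ?h' = {}")
        case True
        then show ?thesis using suppz h' sub(1) zK by auto
      next
        case False
        have "finite (?supp ?h')" using finsupp h' sub(1) by blast
        then have "Max (?supp ?h') < t" using lt False t Max_in by blast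
        then show ?thesis using less.IH h' False by blast
      qed
      then have "?h' \<oplus>\<^bsub>M\<^esub> \<ominus>\<^bsub>M\<^esub> (a \<odot>\<^bsub>M\<^esub> g) \<in> K" using agK subK by blast
      also have "?h' \<oplus>\<^bsub>M\<^esub> \<ominus>\<^bsub>M\<^esub> (a \<odot>\<^bsub>M\<^esub> g) = h"
        using hM gM a by (simp add: M.a_assoc M.r_neg)
      finally show ?case .
    qed
    then show ?thesis using \<open>h \<in> H\<close> suppz sub(1) zK by blast
  qed
  have "H = submodule_gen A M ?S"
    unfolding submodule_gen_def using in_K H SH by blast
  moreover have "finite ?S" using B(2) by simp
  ultimately show ?thesis
    unfolding finitely_generated_submodule_def A_def[symmetric] M_def[symmetric]
    using SH sub(1) by blast
qed

section \<open>Syzygies and coherence\<close>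

definition lincomb :: "('a, 'm) ring_scheme \<Rightarrow> nat \<Rightarrow> (nat \<Rightarrow> 'a) \<Rightarrow> (nat \<Rightarrow> 'a) \<Rightarrow> 'a"
  where "lincomb R s g x = (\<Oplus>\<^bsub>R\<^esub>j\<in>{..<s}. x j \<otimes>\<^bsub>R\<^esub> g j)"

definition syzygies :: "('a, 'm) ring_scheme \<Rightarrow> nat \<Rightarrow> (nat \<Rightarrow> 'a) \<Rightarrow> (nat \<Rightarrow> 'a) set"
  where "syzygies R s g = {x \<in> carrier (free_module R s). lincomb R s g x = \<zero>\<^bsub>R\<^esub>}"

lemma (in ideal) finsum_in_ideal:
  assumes "finite B" and "\<And>j. j \<in> B \<Longrightarrow> f j \<in> I"
  shows "(\<Oplus>j\<in>B. f j) \<in> I"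
  using assms
proof (induction B rule: finite_induct)
  case (insert j B)
  then have "f \<in> B \<rightarrow> carrier R" "f j \<in> carrier R" using a_subset by blast+
  with insert show ?case by (simp add: a_closed)
qed simp

context cring
begin

context
  fixes s :: nat and g :: "nat \<Rightarrow> 'a"
  assumes g: "g \<in> carrier (free_module R s)"
begin

lemma lincomb_closed:
  "x \<in> carrier (free_module R s) \<Longrightarrow> lincomb R s g x \<in> carrier R"
  using g by (auto simp: lincomb_def free_module_simps PiE_iff intro!: finsum_closed)

lemma lincomb_add:
  assumes "x \<in> carrier (free_module R s)" "y \<in> carrier (free_module R s)"
  shows "lincomb R s g (x \<oplus>\<^bsub>free_module R s\<^esub> y) = lincomb R s g x \<oplus> lincomb R s g y"
proof -
  have c: "x j \<in> carrier R" "y j \<in> carrier R" "g j \<in> carrier R" if "j < s" for j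
    using assms g that by (auto simp: free_module_simps)
  have "lincomb R s g (x \<oplus>\<^bsub>free_module R s\<^esub> y) = (\<Oplus>j\<in>{..<s}. x j \<otimes> g j \<oplus> y j \<otimes> g j)"
    unfolding lincomb_def using c
    by (intro finsum_cong') (auto simp: free_module_simps l_distr)
  also have "\<dots> = lincomb R s g x \<oplus> lincomb R s g y"
    unfolding lincomb_def using c by (intro finsum_addf) auto
  finally show ?thesis .
qed

lemma lincomb_smult:
  assumes "a \<in> carrier R" "x \<in> carrier (free_module R s)"
  shows "lincomb R s g (a \<odot>\<^bsub>free_module R s\<^esub> x) = a \<otimes> lincomb R s g x"
proof -
  have c: "x j \<in> carrier R" "g j \<in> carrier R" if "j < s" for j
    using assms g that by (auto simp: free_module_simps)
  have "lincomb R s g (a \<odot>\<^bsub>free_module R s\<^esub> x) = (\<Oplus>j\<in>{..<s}. a \<otimes> (x j \<otimes> g j))"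
    unfolding lincomb_def using c assms(1)
    by (intro finsum_cong') (auto simp: free_module_simps m_assoc)
  also have "\<dots> = a \<otimes> lincomb R s g x"
    unfolding lincomb_def using c assms(1) by (subst finsum_rdistr) auto
  finally show ?thesis .
qed

lemma lincomb_zero: "lincomb R s g \<zero>\<^bsub>free_module R s\<^esub> = \<zero>"
proof -
  have "\<zero>\<^bsub>free_module R s\<^esub> j \<otimes> g j = \<zero>" if "j \<in> {..<s}" for j
  proof -
    have "g j \<in> carrier R" using g that by (auto simp: free_module_simps)
    then show ?thesis using that by (simp add: free_module_simps)
  qed
  then show ?thesis unfolding lincomb_def by (rule add.finprod_one_eqI)
qed

lemma syzygies_submodule: "submodule (syzygies R s g) R (free_module R s)"
proof -
  interpret M: module R "free_module R s" by (rule free_module_module)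
  show ?thesis
    by (rule M.submodule_closedI)
      (simp_all add: syzygies_def lincomb_add lincomb_smult lincomb_zero subset_iff)
qed

text \<open>
  The image is an ideal, being the image of a linear map, and contains the generators, which are the
  images of the unit vectors; and every ideal with these generators contains all their combinations.
\<close>

lemma lincomb_image: "lincomb R s g ` carrier (free_module R s) = Idl (g ` {..<s})"
proof
  let ?M = "free_module R s" and ?S = "g ` {..<s}"
  interpret M: module R ?M by (rule free_module_module)
  have S: "?S \<subseteq> carrier R" using g by (auto simp: free_module_simps)
  interpret J: ideal "Idl ?S" R by (rule genideal_ideal[OF S])
  show "lincomb R s g ` carrier ?M \<subseteq> Idl ?S"
    using genideal_self[OF S]
    by (auto simp: lincomb_def free_module_simps intro!: J.finsum_in_ideal J.I_l_closed)
  have "ideal (lincomb R s g ` carrier ?M) R"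
  proof (rule idealI[OF ring_axioms])
    show "subgroup (lincomb R s g ` carrier ?M) (add_monoid R)"
    proof (rule add.subgroupI)
      show "lincomb R s g ` carrier ?M \<subseteq> carrier R" using lincomb_closed by blast
      show "lincomb R s g ` carrier ?M \<noteq> {}" by blast
      fix a assume "a \<in> lincomb R s g ` carrier ?M"
      then obtain x where x: "x \<in> carrier ?M" "a = lincomb R s g x" by blast
      have "\<ominus> a = lincomb R s g ((\<ominus> \<one>) \<odot>\<^bsub>?M\<^esub> x)"
        using x lincomb_closed[of x] by (simp add: lincomb_smult l_minus)
      then show "\<ominus> a \<in> lincomb R s g ` carrier ?M" using x(1) by simp
      fix b assume "b \<in> lincomb R s g ` carrier ?M"
      then obtain y where y: "y \<in> carrier ?M" "b = lincomb R s g y" by blast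
      with x have "a \<oplus> b = lincomb R s g (x \<oplus>\<^bsub>?M\<^esub> y)" by (simp add: lincomb_add)
      then show "a \<oplus> b \<in> lincomb R s g ` carrier ?M" using x(1) y(1) by simp
    qed
    fix a b assume "a \<in> lincomb R s g ` carrier ?M" and b: "b \<in> carrier R"
    then obtain x where x: "x \<in> carrier ?M" "a = lincomb R s g x" by blast
    then have "b \<otimes> a = lincomb R s g (b \<odot>\<^bsub>?M\<^esub> x)" using b by (simp add: lincomb_smult)
    then show "b \<otimes> a \<in> lincomb R s g ` carrier ?M" using x(1) b by simp
    then show "a \<otimes> b \<in> lincomb R s g ` carrier ?M"
      using x b lincomb_closed by (simp add: m_comm)
  qed
  moreover have "g i \<in> lincomb R s g ` carrier ?M" if i: "i < s" for i
  proof
    let ?e = "\<lambda>j\<in>{..<s}. if j = i then \<one> else \<zero>"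
    show "?e \<in> carrier ?M" by (auto simp: free_module_simps)
    have c: "g j \<in> carrier R" if "j < s" for j using S that by blast
    have "lincomb R s g ?e = (\<Oplus>j\<in>{..<s}. if j = i then g j else \<zero>)"
      unfolding lincomb_def using c by (intro finsum_cong') auto
    also have "\<dots> = g i" using i c by (intro add.finprod_singleton_swap) auto
    finally show "g i = lincomb R s g ?e" ..
  qed
  ultimately show "Idl ?S \<subseteq> lincomb R s g ` carrier ?M" by (intro genideal_minimal) auto
qed

end

text \<open>
  Generators \<open>g\<^sub>0, \<dots>, g\<^sub>s\<^sub>-\<^sub>1\<close> of an ideal define a surjection from \<open>R\<^sup>s\<close> onto it whose kernel
  is the module of syzygies.
\<close>

lemma coherent_ring_syzygiesI:
  assumes syz: "\<And>s g. g \<in> carrier (free_module R s) \<Longrightarrow>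
    finitely_generated_submodule R (free_module R s) (syzygies R s g)"
  shows "coherent_ring R"
proof
  fix S assume S: "finite S" "S \<subseteq> carrier R"
  from S(1) obtain s g0 where g0: "S = g0 ` {..<s::nat}"
    using finite_imp_nat_seg_image_inj_on[OF S(1)] by (auto simp: lessThan_def)
  define g where "g = restrict g0 {..<s}"
  have Sg: "S = g ` {..<s}" using g0 by (auto simp: g_def)
  have g: "g \<in> carrier (free_module R s)"
    using S(2) g0 by (auto simp: free_module_simps g_def)
  let ?N = "ideal_module R (Idl S)"
  have image: "lincomb R s g ` carrier (free_module R s) = carrier ?N"
    by (simp add: ideal_module_def lincomb_image[OF g] Sg)
  have "lincomb R s g \<in> module_hom R (free_module R s) ?N"
    using image unfolding module_hom_def
    by (auto simp: ideal_module_def lincomb_add[OF g] lincomb_smult[OF g])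
  moreover have "{x \<in> carrier (free_module R s). lincomb R s g x = \<zero>\<^bsub>?N\<^esub>} = syzygies R s g"
    by (simp add: syzygies_def ideal_module_def)
  ultimately show "finitely_presented R ?N"
    unfolding finitely_presented_def using image syz[OF g]
    by (intro exI[of _ s] bexI[of _ "lincomb R s g"] conjI) simp_all
qed

end

section \<open>Rings of functions of finite range\<close>

definition vec_map :: "nat \<Rightarrow> ('q \<Rightarrow> 'a) \<Rightarrow> (nat \<Rightarrow> 'q) \<Rightarrow> nat \<Rightarrow> 'a"
  where "vec_map s h x = (\<lambda>j\<in>{..<s}. h (x j))"

text \<open>
  The axioms say that \<open>p \<mapsto> (\<lambda>i. ev i p)\<close> is an isomorphism from \<open>Q\<close> onto the ring of functions of
  finite range from the index type into \<open>A\<close>. Stating them through the evaluations keeps the elements of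
  \<open>Q\<close> abstract, so that polynomials need not be rewritten as functions of the index.
\<close>

locale finite_valued_functions = Q?: cring Q + A: cring A
  for Q :: "('q, 'm) ring_scheme" (structure) and A :: "('a, 'n) ring_scheme" (structure) +
  fixes ev :: "'i \<Rightarrow> 'q \<Rightarrow> 'a"
  assumes ev_hom: "ev i \<in> ring_hom Q A"
    and ev_ext: "\<lbrakk>p \<in> carrier Q; q \<in> carrier Q; \<And>i. ev i p = ev i q\<rbrakk> \<Longrightarrow> p = q"
    and ev_finite: "p \<in> carrier Q \<Longrightarrow> finite (range (\<lambda>i. ev i p))"
    and ev_glue: "\<lbrakk>\<And>i. a i \<in> carrier A; finite (range a)\<rbrakk> \<Longrightarrow> \<exists>p\<in>carrier Q. \<forall>i. ev i p = a i"
begin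

sublocale ev: ring_hom_cring Q A "ev i" for i
  by unfold_locales (rule ev_hom)

context
  fixes s :: nat
begin

abbreviation "QM \<equiv> free_module Q s"
abbreviation "AM \<equiv> free_module A s"
abbreviation "vev i \<equiv> vec_map s (ev i)"

interpretation QM: module Q QM by (rule Q.free_module_module)
interpretation AM: module A AM by (rule A.free_module_module)

lemma vev_closed: "x \<in> carrier QM \<Longrightarrow> vev i x \<in> carrier AM"
  by (auto simp: vec_map_def free_module_simps)

lemma vev_zero: "vev i \<zero>\<^bsub>QM\<^esub> = \<zero>\<^bsub>AM\<^esub>"
  by (auto simp: vec_map_def free_module_simps)

lemma vev_add: "x \<in> carrier QM \<Longrightarrow> y \<in> carrier QM \<Longrightarrow> vev i (x \<oplus>\<^bsub>QM\<^esub> y) = vev i x \<oplus>\<^bsub>AM\<^esub> vev i y"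
  by (auto simp: vec_map_def free_module_simps PiE_iff intro!: restrict_ext)

lemma vev_smult: "a \<in> carrier Q \<Longrightarrow> x \<in> carrier QM \<Longrightarrow> vev i (a \<odot>\<^bsub>QM\<^esub> x) = ev i a \<odot>\<^bsub>AM\<^esub> vev i x"
  by (auto simp: vec_map_def free_module_simps PiE_iff intro!: restrict_ext)

lemma vev_ext:
  assumes x: "x \<in> carrier QM" and y: "y \<in> carrier QM" and eq: "\<And>i. vev i x = vev i y"
  shows "x = y"
proof (rule PiE_ext)
  show "x \<in> (\<Pi>\<^sub>E j\<in>{..<s}. carrier Q)" "y \<in> (\<Pi>\<^sub>E j\<in>{..<s}. carrier Q)"
    using x y by (simp_all add: free_module_simps)
  fix j assume j: "j \<in> {..<s}"
  have "ev i (x j) = ev i (y j)" for i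
    using fun_cong[OF eq[of i], of j] j by (simp add: vec_map_def)
  then show "x j = y j" using x y j by (intro ev_ext) (auto simp: free_module_simps)
qed

lemma vev_finite:
  assumes "x \<in> carrier QM"
  shows "finite (range (\<lambda>i. vev i x))"
proof (rule finite_subset)
  show "range (\<lambda>i. vev i x) \<subseteq> (\<Pi>\<^sub>E j\<in>{..<s}. range (\<lambda>i. ev i (x j)))"
    by (auto simp: vec_map_def split: if_splits)
  show "finite (\<Pi>\<^sub>E j\<in>{..<s}. range (\<lambda>i. ev i (x j)))"
    using assms by (intro finite_PiE ev_finite) (auto simp: free_module_simps)
qed

lemma vev_glue:
  assumes a: "\<And>i. a i \<in> carrier AM" and fin: "finite (range a)"
  shows "\<exists>x\<in>carrier QM. \<forall>i. vev i x = a i"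
proof -
  have "\<exists>p\<in>carrier Q. \<forall>i. ev i p = a i j" if "j < s" for j
  proof (rule ev_glue)
    show "a i j \<in> carrier A" for i using a[of i] that by (auto simp: free_module_simps)
    show "finite (range (\<lambda>i. a i j))"
      using finite_imageI[OF fin, of "\<lambda>u. u j"] by (simp add: image_image)
  qed
  then obtain x where x: "\<And>j. j < s \<Longrightarrow> x j \<in> carrier Q \<and> (\<forall>i. ev i (x j) = a i j)"
    by metis
  show ?thesis
  proof (intro bexI allI)
    show "restrict x {..<s} \<in> carrier QM" using x by (auto simp: free_module_simps)
    show "vev i (restrict x {..<s}) = a i" for i
      using x a[of i]
      by (auto simp: vec_map_def free_module_simps fun_eq_iff PiE_iff extensional_def)
  qed
qed

text \<open>
  Such a vector is unique by \<open>vev_ext\<close>; it exists when \<open>u\<close> has entries in \<open>A\<close>, because it takes at most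
  two values.
\<close>

definition spread :: "'i set \<Rightarrow> (nat \<Rightarrow> 'a) \<Rightarrow> nat \<Rightarrow> 'q"
  where "spread I u =
    (SOME x. x \<in> carrier QM \<and> (\<forall>i. vev i x = (if i \<in> I then u else \<zero>\<^bsub>AM\<^esub>)))"

lemma
  assumes "u \<in> carrier AM"
  shows spread_closed: "spread I u \<in> carrier QM"
    and vev_spread: "vev i (spread I u) = (if i \<in> I then u else \<zero>\<^bsub>AM\<^esub>)"
proof -
  have "finite (range (\<lambda>i. if i \<in> I then u else \<zero>\<^bsub>AM\<^esub>))"
    by (rule finite_subset[of _ "{u, \<zero>\<^bsub>AM\<^esub>}"]) auto
  then have "\<exists>x\<in>carrier QM. \<forall>i. vev i x = (if i \<in> I then u else \<zero>\<^bsub>AM\<^esub>)"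
    using assms by (intro vev_glue) auto
  then have "spread I u \<in> carrier QM \<and> (\<forall>i. vev i (spread I u) = (if i \<in> I then u else \<zero>\<^bsub>AM\<^esub>))"
    unfolding spread_def Bex_def by (rule someI_ex)
  then show "spread I u \<in> carrier QM"
    and "vev i (spread I u) = (if i \<in> I then u else \<zero>\<^bsub>AM\<^esub>)" by blast+
qed

lemma spread_eqI:
  assumes "u \<in> carrier AM" and "x \<in> carrier QM" and "\<And>i. vev i x = (if i \<in> I then u else \<zero>\<^bsub>AM\<^esub>)"
  shows "spread I u = x"
  using assms by (intro vev_ext) (simp_all add: spread_closed vev_spread)

lemma spread_add:
  assumes "u \<in> carrier AM" "w \<in> carrier AM"
  shows "spread I (u \<oplus>\<^bsub>AM\<^esub> w) = spread I u \<oplus>\<^bsub>QM\<^esub> spread I w"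
  using assms by (intro spread_eqI) (auto simp: spread_closed vev_add vev_spread)

text \<open>
  The scalar \<open>p\<close> is the constant function with value \<open>a\<close>, which does not depend on \<open>I\<close>.
\<close>

lemma spread_smult:
  assumes a: "a \<in> carrier A" and u: "u \<in> carrier AM"
  shows "\<exists>p\<in>carrier Q. \<forall>I. spread I (a \<odot>\<^bsub>AM\<^esub> u) = p \<odot>\<^bsub>QM\<^esub> spread I u"
proof -
  obtain p where p: "p \<in> carrier Q" "\<And>i. ev i p = a" using ev_glue[of "\<lambda>_. a"] a by auto
  have "spread I (a \<odot>\<^bsub>AM\<^esub> u) = p \<odot>\<^bsub>QM\<^esub> spread I u" for I
    using a u p by (intro spread_eqI) (auto simp: spread_closed vev_smult vev_spread)
  with p(1) show ?thesis by blast
qed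

text \<open>
  The scalar \<open>p\<close> is the idempotent of \<open>Q\<close> that is the indicator function of \<open>I\<close>.
\<close>

lemma spread_subset:
  assumes "I \<subseteq> J" and u: "u \<in> carrier AM"
  shows "\<exists>p\<in>carrier Q. spread I u = p \<odot>\<^bsub>QM\<^esub> spread J u"
proof -
  have "finite (range (\<lambda>i. if i \<in> I then \<one>\<^bsub>A\<^esub> else \<zero>\<^bsub>A\<^esub>))"
    by (rule finite_subset[of _ "{\<one>\<^bsub>A\<^esub>, \<zero>\<^bsub>A\<^esub>}"]) auto
  then have "\<exists>p\<in>carrier Q. \<forall>i. ev i p = (if i \<in> I then \<one>\<^bsub>A\<^esub> else \<zero>\<^bsub>A\<^esub>)"
    by (intro ev_glue) auto
  then obtain p where p: "p \<in> carrier Q" "\<And>i. ev i p = (if i \<in> I then \<one>\<^bsub>A\<^esub> else \<zero>\<^bsub>A\<^esub>)"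
    by blast
  have "spread I u = p \<odot>\<^bsub>QM\<^esub> spread J u"
    using assms p by (intro spread_eqI) (auto simp: spread_closed vev_smult vev_spread)
  with p(1) show ?thesis by blast
qed

lemma ev_lincomb:
  assumes "g \<in> carrier QM" "x \<in> carrier QM"
  shows "ev i (lincomb Q s g x) = lincomb A s (vev i g) (vev i x)"
proof -
  have c: "x j \<in> carrier Q" "g j \<in> carrier Q" if "j < s" for j
    using assms that by (auto simp: free_module_simps)
  have "ev i (lincomb Q s g x) = (\<Oplus>\<^bsub>A\<^esub>j\<in>{..<s}. (ev i \<circ> (\<lambda>j. x j \<otimes>\<^bsub>Q\<^esub> g j)) j)"
    unfolding lincomb_def using c by (intro ev.hom_finsum) auto
  also have "\<dots> = lincomb A s (vev i g) (vev i x)"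
    unfolding lincomb_def using c by (intro A.finsum_cong') (auto simp: vec_map_def)
  finally show ?thesis .
qed

lemma syzygies_iff:
  assumes g: "g \<in> carrier QM"
  shows "x \<in> syzygies Q s g \<longleftrightarrow> x \<in> carrier QM \<and> (\<forall>i. vev i x \<in> syzygies A s (vev i g))"
proof -
  have "lincomb Q s g x = \<zero>\<^bsub>Q\<^esub> \<longleftrightarrow> (\<forall>i. lincomb A s (vev i g) (vev i x) = \<zero>\<^bsub>A\<^esub>)"
    if x: "x \<in> carrier QM"
  proof -
    have "lincomb Q s g x = \<zero>\<^bsub>Q\<^esub> \<longleftrightarrow> (\<forall>i. ev i (lincomb Q s g x) = ev i \<zero>\<^bsub>Q\<^esub>)"
      using ev_ext[of "lincomb Q s g x" "\<zero>\<^bsub>Q\<^esub>"] Q.lincomb_closed[OF g x] by auto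
    then show ?thesis using ev_lincomb[OF g x] by simp
  qed
  then show ?thesis by (auto simp: syzygies_def vev_closed)
qed

text \<open>
  The generators are those over \<open>A\<close> for each of the finitely many values \<open>t\<close> of the vector \<open>g\<close>,
  spread over the piece of the index set on which \<open>g\<close> has the value \<open>t\<close>. To see that a submodule
  \<open>K\<close> containing them contains every syzygy \<open>x\<close>, cut the index set into the parts on which \<open>g\<close>
  and \<open>x\<close> are both constant: \<open>x\<close> is the sum of its restrictions to these parts.
\<close>

theorem syzygies_finitely_generated:
  assumes A_syz: "\<And>t. t \<in> carrier AM \<Longrightarrow> finitely_generated_submodule A AM (syzygies A s t)"
    and g: "g \<in> carrier QM"
  shows "finitely_generated_submodule Q QM (syzygies Q s g)"
proof -
  define T where "T = range (\<lambda>i. vev i g)"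
  have T: "t \<in> carrier AM" if "t \<in> T" for t using that g vev_closed by (auto simp: T_def)
  define piece where "piece t = {i. vev i g = t}" for t
  have "\<exists>S. finite S \<and> S \<subseteq> carrier AM \<and> syzygies A s t = submodule_gen A AM S" if "t \<in> T" for t
    using A_syz[OF T[OF that]] unfolding finitely_generated_submodule_def .
  then obtain S where S: "\<And>t. t \<in> T \<Longrightarrow> finite (S t)" "\<And>t. t \<in> T \<Longrightarrow> S t \<subseteq> carrier AM"
    "\<And>t. t \<in> T \<Longrightarrow> syzygies A s t = submodule_gen A AM (S t)" by metis
  define G where "G = (\<Union>t\<in>T. spread (piece t) ` S t)"
  have "finite T" using vev_finite[OF g] by (simp add: T_def)
  then have finG: "finite G" using S(1) by (simp add: G_def)
  have G_syz: "G \<subseteq> syzygies Q s g"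
  proof
    fix x assume "x \<in> G"
    then obtain t v where t: "t \<in> T" and v: "v \<in> S t" and x: "x = spread (piece t) v"
      by (auto simp: G_def)
    have vM: "v \<in> carrier AM" using S(2) t v by blast
    have "v \<in> syzygies A s t" using v S(3)[OF t] by (auto simp: submodule_gen_def)
    moreover have "\<zero>\<^bsub>AM\<^esub> \<in> syzygies A s (vev i g)" for i
      using A.lincomb_zero[OF vev_closed[OF g]] by (simp add: syzygies_def)
    ultimately show "x \<in> syzygies Q s g"
      unfolding x syzygies_iff[OF g] using vM by (auto simp: spread_closed vev_spread piece_def)
  qed
  have in_K: "x \<in> K" if K: "submodule K Q QM" "G \<subseteq> K" and x: "x \<in> syzygies Q s g" for K x
  proof -
    note subK = QM.submoduleE[OF K(1)]
    have zK: "\<zero>\<^bsub>QM\<^esub> \<in> K"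
      using subgroup.one_closed[OF submodule.axioms(1)[OF K(1)]] by simp
    have spread_K: "spread I u \<in> K" if t: "t \<in> T" and u: "u \<in> syzygies A s t" and I: "I \<subseteq> piece t"
      for t u I
    proof -
      \<comment> \<open>Rather than write \<open>u\<close> as a combination of \<open>S t\<close>, show that the vectors with the
        desired property form a submodule; the property has to speak about all \<open>I\<close> simultaneously.\<close>
      define W where "W = {u \<in> carrier AM. \<forall>I\<subseteq>piece t. spread I u \<in> K}"
      have "submodule W A AM"
      proof (rule AM.submodule_closedI)
        show "\<zero>\<^bsub>AM\<^esub> \<in> W"
          unfolding W_def using zK spread_eqI[of "\<zero>\<^bsub>AM\<^esub>" "\<zero>\<^bsub>QM\<^esub>"] by (auto simp: vev_zero)
        show "a \<odot>\<^bsub>AM\<^esub> w \<in> W" if "a \<in> carrier A" "w \<in> W" for a w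
          using that spread_smult[of a w] subK(4) unfolding W_def by fastforce
      qed (use subK(5) in \<open>auto simp: W_def spread_add\<close>)
      moreover have "S t \<subseteq> W"
      proof
        fix v assume v: "v \<in> S t"
        then have vM: "v \<in> carrier AM" using S(2) t by blast
        have "spread (piece t) v \<in> K" using K(2) t v by (auto simp: G_def)
        then have "spread I v \<in> K" if "I \<subseteq> piece t" for I
          using spread_subset[OF that vM] subK(4) by auto
        with vM show "v \<in> W" by (simp add: W_def)
      qed
      ultimately have "syzygies A s t \<subseteq> W" unfolding S(3)[OF t] submodule_gen_def by blast
      with u I show ?thesis by (auto simp: W_def)
    qed
    have xM: "x \<in> carrier QM" and xi: "\<And>i. vev i x \<in> syzygies A s (vev i g)"
      using x syzygies_iff[OF g] by blast+
    define val where "val i = (vev i g, vev i x)" for i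
    have finV: "finite (range val)"
      using finite_subset[of "range val" "range (\<lambda>i. vev i g) \<times> range (\<lambda>i. vev i x)"]
        vev_finite[OF g] vev_finite[OF xM] by (auto simp: val_def)
    \<comment> \<open>Here \<open>y\<close> is the part of \<open>x\<close> on the indices whose joint value lies in \<open>V\<close>.\<close>
    have part: "y \<in> K" if "finite V" "V \<subseteq> range val" "y \<in> carrier QM"
      "\<And>i. vev i y = (if val i \<in> V then vev i x else \<zero>\<^bsub>AM\<^esub>)" for V y
      using that
    proof (induction V arbitrary: y rule: finite_induct)
      case empty
      then have "y = \<zero>\<^bsub>QM\<^esub>" by (intro vev_ext) (auto simp: vev_zero)
      with zK show ?case by simp
    next
      case (insert v V)
      obtain i0 where v: "v = val i0" using insert.prems(1) by blast
      let ?I = "{i. val i = v}" and ?u = "vev i0 x"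
      have uM: "?u \<in> carrier AM" using xM by (rule vev_closed)
      have "spread ?I ?u \<in> K"
        using xi[of i0] by (intro spread_K[of "vev i0 g"]) (auto simp: T_def piece_def v val_def)
      moreover have "\<exists>z\<in>carrier QM. \<forall>i. vev i z = (if val i \<in> V then vev i x else \<zero>\<^bsub>AM\<^esub>)"
      proof (rule vev_glue)
        show "finite (range (\<lambda>i. if val i \<in> V then vev i x else \<zero>\<^bsub>AM\<^esub>))"
          by (rule finite_subset[of _ "insert \<zero>\<^bsub>AM\<^esub> (range (\<lambda>i. vev i x))"])
            (auto simp: vev_finite[OF xM])
      qed (use xM vev_closed in auto)
      then obtain z where z: "z \<in> carrier QM"
        "\<And>i. vev i z = (if val i \<in> V then vev i x else \<zero>\<^bsub>AM\<^esub>)" by blast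
      have "z \<in> K" using insert.IH z insert.prems(1) by auto
      moreover have "y = spread ?I ?u \<oplus>\<^bsub>QM\<^esub> z"
      proof (rule vev_ext)
        fix i
        have "vev i x = ?u" if "val i = v" using that by (simp add: v val_def)
        then show "vev i y = vev i (spread ?I ?u \<oplus>\<^bsub>QM\<^esub> z)"
          using insert.prems(3)[of i] insert.hyps(2) z uM vev_closed[OF xM, of i]
          by (auto simp: vev_add spread_closed vev_spread)
      qed (use insert.prems(2) z uM spread_closed in auto)
      ultimately show ?case using subK(5) by blast
    qed
    show "x \<in> K" using part[OF finV subset_refl xM] by simp
  qed
  have "syzygies Q s g = submodule_gen Q QM G"
    unfolding submodule_gen_def using in_K G_syz Q.syzygies_submodule[OF g] by blast
  then show ?thesis
    unfolding finitely_generated_submodule_def using finG G_syz by (auto simp: syzygies_def)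
qed

end

end

section \<open>Polynomials over a power of a finite field\<close>

text \<open>
  If \<open>p\<close> has support \<open>M\<close>, then each \<open>\<lambda>m. p m i\<close> is one of the finitely many functions from
  \<open>M\<close> to \<open>carrier F\<close>, extended by zero. Conversely, the supports of finitely many polynomials have a finite
  union, so a function of finite range into \<open>F[X\<^sub>1, \<dots>, X\<^sub>n]\<close> has only finitely many coefficient sequences
  that are not identically zero.
\<close>

lemma mpoly_product_ring_finite_valued:
  fixes F :: "('a, 'b) ring_scheme"
  assumes F: "cring F" and fin: "finite (carrier F)"
  shows "finite_valued_functions (mpoly_ring (product_ring (UNIV :: 'i set) (\<lambda>_. F)) n) (mpoly_ring F n)
    (\<lambda>i p m. p m i)"
proof -
  let ?P = "product_ring (UNIV :: 'i set) (\<lambda>_. F)"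
  let ?Q = "mpoly_ring ?P n" and ?A = "mpoly_ring F n"
  interpret F: cring F by fact
  interpret P: cring ?P by (rule product_ring_cring) (rule F)
  have proj: "ring_hom_cring ?P F (\<lambda>x. x i)" for i
    by (rule product_ring_proj[of "\<lambda>_. F", OF F])
  have coeff: "p m i \<in> carrier F" if "p \<in> carrier ?Q" for p m i
  proof -
    have "p m \<in> carrier ?P" using that by (rule mpoly_coeff_closed)
    then show ?thesis unfolding product_ring_simps by blast
  qed
  show ?thesis
  proof (intro finite_valued_functions.intro finite_valued_functions_axioms.intro
      F.mpoly_ring_cring P.mpoly_ring_cring)
    show "(\<lambda>p m. p m i) \<in> ring_hom ?Q ?A" for i
    proof (rule ring_hom_memI)
      fix p q assume p: "p \<in> carrier ?Q" and q: "q \<in> carrier ?Q"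
      show "(\<lambda>m. p m i) \<in> carrier ?A"
      proof (rule mpoly_carrierI[OF _ mpoly_finite_support[OF p]])
        fix m
        show "p m i \<in> carrier F" using p by (rule coeff)
        assume "p m i \<noteq> \<zero>\<^bsub>F\<^esub>"
        then have "p m \<noteq> \<zero>\<^bsub>?P\<^esub>" unfolding product_ring_simps by auto
        then show "m \<in> {m. p m \<noteq> \<zero>\<^bsub>?P\<^esub>}" and "set_mset m \<subseteq> {..<n}"
          using mpoly_vars[OF p] by blast+
      qed
      show "(\<lambda>m. (p \<oplus>\<^bsub>?Q\<^esub> q) m i) = (\<lambda>m. p m i) \<oplus>\<^bsub>?A\<^esub> (\<lambda>m. q m i)"
        by (simp add: mpoly_ring_simps product_ring_simps)
      show "(\<lambda>m. (p \<otimes>\<^bsub>?Q\<^esub> q) m i) = (\<lambda>m. p m i) \<otimes>\<^bsub>?A\<^esub> (\<lambda>m. q m i)"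
      proof
        fix m
        have "(\<Oplus>\<^bsub>?P\<^esub>k\<in>{k. k \<subseteq># m}. p k \<otimes>\<^bsub>?P\<^esub> q (m - k)) i
            = (\<Oplus>\<^bsub>F\<^esub>k\<in>{k. k \<subseteq># m}. ((\<lambda>x. x i) \<circ> (\<lambda>k. p k \<otimes>\<^bsub>?P\<^esub> q (m - k))) k)"
          using p q by (intro ring_hom_cring.hom_finsum[OF proj]) auto
        then show "(p \<otimes>\<^bsub>?Q\<^esub> q) m i = ((\<lambda>m. p m i) \<otimes>\<^bsub>?A\<^esub> (\<lambda>m. q m i)) m"
          by (simp add: mpoly_ring_simps product_ring_simps)
      qed
    qed (auto simp: mpoly_ring_simps product_ring_simps)
    show "p = q" if "\<And>i. (\<lambda>m. p m i) = (\<lambda>m. q m i)" for p q :: "nat multiset \<Rightarrow> 'i \<Rightarrow> 'a"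
      using that by (auto simp: fun_eq_iff)
    show "finite (range (\<lambda>i m. p m i))" if p: "p \<in> carrier ?Q" for p
    proof (rule finite_subset[OF _ finite_set_of_finite_funs[OF mpoly_finite_support[OF p] fin]])
      show "range (\<lambda>i m. p m i) \<subseteq> {f. \<forall>m. (m \<in> {m. p m \<noteq> \<zero>\<^bsub>?P\<^esub>} \<longrightarrow> f m \<in> carrier F) \<and>
          (m \<notin> {m. p m \<noteq> \<zero>\<^bsub>?P\<^esub>} \<longrightarrow> f m = \<zero>\<^bsub>F\<^esub>)}"
        using coeff[OF p] by (auto simp: product_ring_simps)
    qed
    show "\<exists>p\<in>carrier ?Q. \<forall>i. (\<lambda>m. p m i) = a i"
      if a: "\<And>i. a i \<in> carrier ?A" and "finite (range a)" for a :: "'i \<Rightarrow> nat multiset \<Rightarrow> 'a"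
    proof (intro bexI allI)
      let ?M = "\<Union>q\<in>range a. {m. q m \<noteq> \<zero>\<^bsub>F\<^esub>}"
      have ex: "\<exists>i. a i m \<noteq> \<zero>\<^bsub>F\<^esub>" if "(\<lambda>i. a i m) \<noteq> \<zero>\<^bsub>?P\<^esub>" for m
        using that by (auto simp: product_ring_simps)
      show "(\<lambda>m i. a i m) \<in> carrier ?Q"
      proof (rule mpoly_carrierI[where M = ?M])
        show "(\<lambda>i. a i m) \<in> carrier ?P" for m
          using mpoly_coeff_closed[OF a] unfolding product_ring_simps by blast
        show "finite ?M" using \<open>finite (range a)\<close> a mpoly_finite_support by blast
        show "m \<in> ?M" if "(\<lambda>i. a i m) \<noteq> \<zero>\<^bsub>?P\<^esub>" for m using ex[OF that] by blast
        show "set_mset m \<subseteq> {..<n}" if "(\<lambda>i. a i m) \<noteq> \<zero>\<^bsub>?P\<^esub>" for m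
          using ex[OF that] mpoly_vars[OF a] by blast
      qed
    qed simp
  qed
qed

theorem corollary5p4:
  fixes F :: "('a, 'b) ring_scheme"
  assumes "field F" and "finite (carrier F)"
  shows "stably_coherent_ring (product_ring (UNIV :: nat set) (\<lambda>_. F))"
proof -
  interpret F: field F by fact
  let ?P = "product_ring (UNIV :: nat set) (\<lambda>_. F)"
  interpret P: cring ?P by (rule product_ring_cring) (rule F.is_cring)
  show ?thesis
  proof (intro stably_coherent_ring.intro stably_coherent_ring_axioms.intro P.is_cring)
    fix n
    let ?A = "mpoly_ring F n"
    interpret finite_valued_functions "mpoly_ring ?P n" ?A "\<lambda>i p m. p m i"
      using F.is_cring assms(2) by (rule mpoly_product_ring_finite_valued)
    show "coherent_ring (mpoly_ring ?P n)"
    proof (rule Q.coherent_ring_syzygiesI)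
      fix s g assume "g \<in> carrier (free_module (mpoly_ring ?P n) s)"
      then show "finitely_generated_submodule (mpoly_ring ?P n)
          (free_module (mpoly_ring ?P n) s) (syzygies (mpoly_ring ?P n) s g)"
        by (intro syzygies_finitely_generated F.submodule_mpoly_finitely_generated
            A.syzygies_submodule)
    qed
  qed
qed

end
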